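(* Let $R$ be an integral domain (a unital commutative ring without zero divisors), let $(\mathbb X,T)$ be a tangent category, and let $\dim$ be a strong $R$-valued tangent dimension on $(\mathbb X,T)$. Then for every object $X$ of $\mathbb X$, $\dim(T(X))=\dim(X)$ or $\dim(T(X))=2\cdot\dim(X)$ holds.
   Context: Additive bundles. An additive bundle $(X,A,p,+,0)$ over an object $A$ of a category is a morphism $p:X\to A$ all of whose finite pullback powers $X_n$ (the $n$-fold fibre product of $X$ with itself over $A$) exist, together with morphisms $+:X_2\to X$ and $0:A\to X$ such that $p\circ + = p\circ\pi_0=p\circ\pi_1$, $p\circ 0=1_A$, and $+$ is associative, commutative and unital with unit $0$ (i.e. $+\circ\langle 0\circ p,1_X\rangle=1_X$). An additive bundle morphism $(X,A,p,+,0)\to(Y,B,p',+',0')$ is a pair $f:X\to Y$, $g:A\to B$ with $p'\circ f=g\circ p$, $f\circ + = +'\circ\langle f\pi_0,f\pi_1\rangle$ and $f\circ 0=0'\circ g$. Tangent category. A tangent category $(\mathbb X,T,p,0,+,\ell,c)$, abbreviated $(\mathbb X,T)$, consists of a category $\mathbb X$ and: a functor $T:\mathbb X\to\mathbb X$ and a natural transformation $p:T\to 1$ such that all pullback powers $T_nM$ of $p_M:TM\to M$ exist and are preserved by $T$; natural transformations $+:T_2\to T$ and $0:1\to T$ making each $(TM,M,p_M,+_M,0_M)$ an additive bundle; a natural transformation $\ell:T\to T^2$ such that $(\ell_M,0_M)$ is an additive bundle morphism from $(TM,M,p_M,+_M,0_M)$ to $(T^2M,TM,T(p_M),T(+_M),T(0_M))$;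 a natural transformation $c:T^2\to T^2$ with $c\circ c=1$ and $c\circ\ell=\ell$ such that $(c_M,1)$ is an additive bundle morphism from $(T^2M,TM,T(p_M),T(+_M),T(0_M))$ to $(T^2M,TM,p_{TM},+_{TM},0_{TM})$. Moreover $T(\ell_M)\circ\ell_M=\ell_{TM}\circ\ell_M$, $c_{TM}\circ T(c_M)\circ c_{TM}=T(c_M)\circ c_{TM}\circ T(c_M)$, $c_{TM}\circ T(c_M)\circ\ell_{TM}=T(\ell_M)\circ c_M$, and (universality of the vertical lift) the commutative square with top $\nu:T_2M\to T^2M$, $\nu=T(+_M)\circ\langle\ell_M\circ\pi_0,0_{TM}\circ\pi_1\rangle$, left side $p_M\circ\pi_0:T_2M\to M$, right side $T(p_M):T^2M\to TM$ and bottom $0_M:M\to TM$ is a pullback preserved by all powers of $T$. Here $T^2=T\circ T$, while $T_2$ denotes the pullback of $p$ along itself. Tangent dimension. $\pi_0(\mathbb X)$ denotes the collection of isomorphism classes of objects of $\mathbb X$. A $T$-pullback is a pullback square preserved by all powers of $T$. For a commutative monoid $M$, an $M$-valued tangent dimension on $(\mathbb X,T)$ is a function $\dim:\pi_0(\mathbb X)\to M$ such that for every $T$-pullback $A\times_B C$ of a morphism $f:C\to B$ along a retraction (split epimorphism) $r:A\to B$, if $f$ is a retraction or $f$ is a section (split monomorphism), then $\dim(A\times_B C)+\dim(B)=\dim(A)+\dim(C)$. It is strong if $M$ is a commutative rig (with its additive monoid structure used above) and there is an element $a\in M$ such that $\dim(T(X))=a\cdot\dim(X)$ for every object $X$ of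 $\mathbb X$. A ring $R$ is regarded as a rig. *)

theory Defs
  imports Main
begin

section \<open>Categories, functors and natural transformations\<close>

record ('o, 'm) cat =
  Obj :: "'o set"
  Arr :: "'m set"
  Dom :: "'m \<Rightarrow> 'o"
  Cod :: "'m \<Rightarrow> 'o"
  Ident :: "'o \<Rightarrow> 'm"
  Comp :: "'m \<Rightarrow> 'm \<Rightarrow> 'm"  (infixl "\<cdot>\<index>" 70)

text \<open>Composition is written in applicative order: \<open>g \<cdot> f\<close> is ``first \<open>f\<close>, then \<open>g\<close>''.\<close>

definition Hom :: "('o, 'm, 'z) cat_scheme \<Rightarrow> 'o \<Rightarrow> 'o \<Rightarrow> 'm set" where
  "Hom C A B = {f \<in> Arr C. Dom C f = A \<and> Cod C f = B}"

locale category =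
  fixes C :: "('o, 'm, 'z) cat_scheme" (structure)
  assumes Dom_closed: "f \<in> Arr C \<Longrightarrow> Dom C f \<in> Obj C"
    and Cod_closed: "f \<in> Arr C \<Longrightarrow> Cod C f \<in> Obj C"
    and Id_Hom: "A \<in> Obj C \<Longrightarrow> Ident C A \<in> Hom C A A"
    and Comp_Hom: "f \<in> Hom C A B \<Longrightarrow> g \<in> Hom C B D \<Longrightarrow> g \<cdot> f \<in> Hom C A D"
    and Comp_Id: "f \<in> Hom C A B \<Longrightarrow> f \<cdot> Ident C A = f"
    and Id_Comp: "f \<in> Hom C A B \<Longrightarrow> Ident C B \<cdot> f = f"
    and Comp_assoc: "f \<in> Hom C A B \<Longrightarrow> g \<in> Hom C B D \<Longrightarrow> h \<in> Hom C D E
                     \<Longrightarrow> (h \<cdot> g) \<cdot> f = h \<cdot> (g \<cdot> f)"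

record ('o, 'm) endo =
  ob :: "'o \<Rightarrow> 'o"
  ar :: "'m \<Rightarrow> 'm"

locale endofunctor =
  fixes C :: "('o, 'm, 'z) cat_scheme" (structure)
    and F :: "('o, 'm, 'y) endo_scheme"
  assumes ob_closed: "A \<in> Obj C \<Longrightarrow> ob F A \<in> Obj C"
    and ar_Hom: "f \<in> Hom C A B \<Longrightarrow> ar F f \<in> Hom C (ob F A) (ob F B)"
    and ar_Id: "A \<in> Obj C \<Longrightarrow> ar F (Ident C A) = Ident C (ob F A)"
    and ar_Comp: "f \<in> Hom C A B \<Longrightarrow> g \<in> Hom C B D \<Longrightarrow> ar F (g \<cdot> f) = ar F g \<cdot> ar F f"

definition endo_id :: "('o, 'm) endo" where
  "endo_id = \<lparr> ob = (\<lambda>A. A), ar = (\<lambda>f. f) \<rparr>"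

definition endo_comp :: "('o, 'm, 'y) endo_scheme \<Rightarrow> ('o, 'm, 'x) endo_scheme \<Rightarrow> ('o, 'm) endo" where
  "endo_comp F G = \<lparr> ob = ob F \<circ> ob G, ar = ar F \<circ> ar G \<rparr>"

definition nat_trans ::
  "('o, 'm, 'z) cat_scheme \<Rightarrow> ('o, 'm, 'y) endo_scheme \<Rightarrow> ('o, 'm, 'x) endo_scheme
   \<Rightarrow> ('o \<Rightarrow> 'm) \<Rightarrow> bool" where
  "nat_trans C F G \<alpha> \<longleftrightarrow>
     (\<forall>A\<in>Obj C. \<alpha> A \<in> Hom C (ob F A) (ob G A)) \<and>
     (\<forall>A\<in>Obj C. \<forall>B\<in>Obj C. \<forall>f\<in>Hom C A B. ar G f \<cdot>\<^bsub>C\<^esub> \<alpha> A = \<alpha> B \<cdot>\<^bsub>C\<^esub> ar F f)"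

definition isomorphic :: "('o, 'm, 'z) cat_scheme \<Rightarrow> 'o \<Rightarrow> 'o \<Rightarrow> bool" where
  "isomorphic C A B \<longleftrightarrow>
     (\<exists>f\<in>Hom C A B. \<exists>g\<in>Hom C B A. g \<cdot>\<^bsub>C\<^esub> f = Ident C A \<and> f \<cdot>\<^bsub>C\<^esub> g = Ident C B)"

definition iso_class :: "('o, 'm, 'z) cat_scheme \<Rightarrow> 'o \<Rightarrow> 'o set" where
  "iso_class C A = {B \<in> Obj C. isomorphic C A B}"

definition is_retraction :: "('o, 'm, 'z) cat_scheme \<Rightarrow> 'm \<Rightarrow> bool" where
  "is_retraction C r \<longleftrightarrow> r \<in> Arr C \<and>
     (\<exists>s\<in>Hom C (Cod C r) (Dom C r). r \<cdot>\<^bsub>C\<^esub> s = Ident C (Cod C r))"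

definition is_section :: "('o, 'm, 'z) cat_scheme \<Rightarrow> 'm \<Rightarrow> bool" where
  "is_section C s \<longleftrightarrow> s \<in> Arr C \<and>
     (\<exists>r\<in>Hom C (Cod C s) (Dom C s). r \<cdot>\<^bsub>C\<^esub> s = Ident C (Dom C s))"


section \<open>Pullbacks and fibre powers\<close>

text \<open>\<open>is_pullback C f g P p q\<close>: the square \<open>f \<cdot> p = g \<cdot> q\<close> with corner \<open>P\<close> is a pullback of
  \<open>f\<close> and \<open>g\<close>; \<open>p\<close> lands in the domain of \<open>f\<close> and \<open>q\<close> in the domain of \<open>g\<close>.\<close>

definition is_pullback ::
  "('o, 'm, 'z) cat_scheme \<Rightarrow> 'm \<Rightarrow> 'm \<Rightarrow> 'o \<Rightarrow> 'm \<Rightarrow> 'm \<Rightarrow> bool" where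
  "is_pullback C f g P p q \<longleftrightarrow>
     f \<in> Arr C \<and> g \<in> Arr C \<and> Cod C f = Cod C g \<and> P \<in> Obj C \<and>
     p \<in> Hom C P (Dom C f) \<and> q \<in> Hom C P (Dom C g) \<and> f \<cdot>\<^bsub>C\<^esub> p = g \<cdot>\<^bsub>C\<^esub> q \<and>
     (\<forall>Z\<in>Obj C. \<forall>x\<in>Hom C Z (Dom C f). \<forall>y\<in>Hom C Z (Dom C g).
        f \<cdot>\<^bsub>C\<^esub> x = g \<cdot>\<^bsub>C\<^esub> y \<longrightarrow>
        (\<exists>!u. u \<in> Hom C Z P \<and> p \<cdot>\<^bsub>C\<^esub> u = x \<and> q \<cdot>\<^bsub>C\<^esub> u = y))"

text \<open>The mediating morphism \<open>\<langle>x, y\<rangle>\<close> into the pullback with projections \<open>p\<close>, \<open>q\<close>.\<close>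

definition pairing :: "('o, 'm, 'z) cat_scheme \<Rightarrow> 'm \<Rightarrow> 'm \<Rightarrow> 'm \<Rightarrow> 'm \<Rightarrow> 'm" where
  "pairing C p q x y =
     (THE u. u \<in> Hom C (Dom C x) (Dom C p) \<and> p \<cdot>\<^bsub>C\<^esub> u = x \<and> q \<cdot>\<^bsub>C\<^esub> u = y)"

text \<open>\<open>is_fibre_power C p n P b \<pi>\<close>: \<open>P\<close> is the \<open>n\<close>-fold fibre product of \<open>p : X \<rightarrow> A\<close> with itself,
  with projections \<open>\<pi> i : P \<rightarrow> X\<close> for \<open>i < n\<close> and structure map \<open>b : P \<rightarrow> A\<close>.  The structure map is
  determined by the projections unless \<open>n = 0\<close>, where the fibre power is \<open>A\<close> itself.\<close>

definition is_fibre_power ::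
  "('o, 'm, 'z) cat_scheme \<Rightarrow> 'm \<Rightarrow> nat \<Rightarrow> 'o \<Rightarrow> 'm \<Rightarrow> (nat \<Rightarrow> 'm) \<Rightarrow> bool" where
  "is_fibre_power C p n P b \<pi> \<longleftrightarrow>
     p \<in> Arr C \<and> P \<in> Obj C \<and> b \<in> Hom C P (Cod C p) \<and>
     (\<forall>i<n. \<pi> i \<in> Hom C P (Dom C p) \<and> p \<cdot>\<^bsub>C\<^esub> \<pi> i = b) \<and>
     (\<forall>Z\<in>Obj C. \<forall>h\<in>Hom C Z (Cod C p). \<forall>x.
        (\<forall>i<n. x i \<in> Hom C Z (Dom C p) \<and> p \<cdot>\<^bsub>C\<^esub> x i = h) \<longrightarrow>
        (\<exists>!u. u \<in> Hom C Z P \<and> b \<cdot>\<^bsub>C\<^esub> u = h \<and> (\<forall>i<n. \<pi> i \<cdot>\<^bsub>C\<^esub> u = x i)))"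


section \<open>Additive bundles\<close>

text \<open>The pullback \<open>X\<^sub>2\<close> on which the addition is defined is part of the data, together with its
  projections, since \<open>+ : X\<^sub>2 \<rightarrow> X\<close> only makes sense relative to a choice of \<open>X\<^sub>2\<close>.\<close>

record ('o, 'm) additive_data =
  total :: "'o"
  base :: "'o"
  bproj :: "'m"
  bpow2 :: "'o"
  bpi0 :: "'m"
  bpi1 :: "'m"
  badd :: "'m"
  bzero :: "'m"

text \<open>Associativity is an equation between morphisms out of the threefold fibre power; it is
  required for every such power, which amounts to requiring it for one.\<close>

locale additive_bundle =
  fixes C :: "('o, 'm, 'z) cat_scheme" (structure)
    and E :: "('o, 'm, 'y) additive_data_scheme"
  assumes bproj_Hom: "bproj E \<in> Hom C (total E) (base E)"
    and fibre_powers_exist: "\<exists>P b \<pi>. is_fibre_power C (bproj E) n P b \<pi>"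
    and bpow2_pullback: "is_pullback C (bproj E) (bproj E) (bpow2 E) (bpi0 E) (bpi1 E)"
    and badd_Hom: "badd E \<in> Hom C (bpow2 E) (total E)"
    and bzero_Hom: "bzero E \<in> Hom C (base E) (total E)"
    and bproj_badd0: "bproj E \<cdot> badd E = bproj E \<cdot> bpi0 E"
    and bproj_badd1: "bproj E \<cdot> badd E = bproj E \<cdot> bpi1 E"
    and bproj_bzero: "bproj E \<cdot> bzero E = Ident C (base E)"
    and badd_assoc: "is_fibre_power C (bproj E) 3 P b \<pi> \<Longrightarrow>
      badd E \<cdot> pairing C (bpi0 E) (bpi1 E)
                 (badd E \<cdot> pairing C (bpi0 E) (bpi1 E) (\<pi> 0) (\<pi> 1)) (\<pi> 2) =
      badd E \<cdot> pairing C (bpi0 E) (bpi1 E)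
                 (\<pi> 0) (badd E \<cdot> pairing C (bpi0 E) (bpi1 E) (\<pi> 1) (\<pi> 2))"
    and badd_commute: "badd E \<cdot> pairing C (bpi0 E) (bpi1 E) (bpi1 E) (bpi0 E) = badd E"
    and badd_unit: "badd E \<cdot> pairing C (bpi0 E) (bpi1 E) (bzero E \<cdot> bproj E) (Ident C (total E))
                    = Ident C (total E)"

locale additive_bundle_morphism =
  dom: additive_bundle C E + cod: additive_bundle C E'
  for C :: "('o, 'm, 'z) cat_scheme" (structure)
    and E :: "('o, 'm, 'y) additive_data_scheme"
    and E' :: "('o, 'm, 'x) additive_data_scheme" +
  fixes f g :: "'m"
  assumes f_Hom: "f \<in> Hom C (total E) (total E')"
    and g_Hom: "g \<in> Hom C (base E) (base E')"
    and commutes_proj: "bproj E' \<cdot> f = g \<cdot> bproj E"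
    and commutes_add: "f \<cdot> badd E =
      badd E' \<cdot> pairing C (bpi0 E') (bpi1 E') (f \<cdot> bpi0 E) (f \<cdot> bpi1 E)"
    and commutes_zero: "f \<cdot> bzero E = bzero E' \<cdot> g"


section \<open>Tangent categories\<close>

text \<open>\<open>T2 M\<close> with \<open>tpi0 M\<close>, \<open>tpi1 M\<close> is a choice of pullback of \<open>tproj M\<close> along itself.\<close>

record ('o, 'm) tangent = "('o, 'm) endo" +
  tproj :: "'o \<Rightarrow> 'm"
  T2 :: "'o \<Rightarrow> 'o"
  tpi0 :: "'o \<Rightarrow> 'm"
  tpi1 :: "'o \<Rightarrow> 'm"
  tzero :: "'o \<Rightarrow> 'm"
  tadd :: "'o \<Rightarrow> 'm"
  tlift :: "'o \<Rightarrow> 'm"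
  tflip :: "'o \<Rightarrow> 'm"

definition T2_functor ::
  "('o, 'm, 'z) cat_scheme \<Rightarrow> ('o, 'm, 'y) tangent_scheme \<Rightarrow> ('o, 'm) endo" where
  "T2_functor C T =
     \<lparr> ob = T2 T,
       ar = (\<lambda>f. pairing C (tpi0 T (Cod C f)) (tpi1 T (Cod C f))
                  (ar T f \<cdot>\<^bsub>C\<^esub> tpi0 T (Dom C f)) (ar T f \<cdot>\<^bsub>C\<^esub> tpi1 T (Dom C f))) \<rparr>"

text \<open>The bundle \<open>(TM, M, p\<^sub>M, +\<^sub>M, 0\<^sub>M)\<close>.\<close>

definition tangent_bundle :: "('o, 'm, 'y) tangent_scheme \<Rightarrow> 'o \<Rightarrow> ('o, 'm) additive_data" where
  "tangent_bundle T M =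
     \<lparr> total = ob T M, base = M, bproj = tproj T M,
       bpow2 = T2 T M, bpi0 = tpi0 T M, bpi1 = tpi1 T M,
       badd = tadd T M, bzero = tzero T M \<rparr>"

text \<open>The bundle \<open>(T\<^sup>2M, TM, T(p\<^sub>M), T(+\<^sub>M), T(0\<^sub>M))\<close>.  The domain of \<open>T(+\<^sub>M)\<close> is \<open>T(T\<^sub>2M)\<close>, which is
  a pullback of \<open>T(p\<^sub>M)\<close> along itself because \<open>T\<close> preserves fibre powers of \<open>p\<^sub>M\<close>.\<close>

definition T_tangent_bundle :: "('o, 'm, 'y) tangent_scheme \<Rightarrow> 'o \<Rightarrow> ('o, 'm) additive_data" where
  "T_tangent_bundle T M =
     \<lparr> total = ob T (ob T M), base = ob T M, bproj = ar T (tproj T M),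
       bpow2 = ob T (T2 T M), bpi0 = ar T (tpi0 T M), bpi1 = ar T (tpi1 T M),
       badd = ar T (tadd T M), bzero = ar T (tzero T M) \<rparr>"

text \<open>\<open>\<nu>\<^sub>M = T(+\<^sub>M) \<cdot> \<langle>\<ell>\<^sub>M \<cdot> \<pi>\<^sub>0, 0\<^bsub>TM\<^esub> \<cdot> \<pi>\<^sub>1\<rangle> : T\<^sub>2M \<rightarrow> T\<^sup>2M\<close>, the pairing being into \<open>T(T\<^sub>2M)\<close>.\<close>

definition nu :: "('o, 'm, 'z) cat_scheme \<Rightarrow> ('o, 'm, 'y) tangent_scheme \<Rightarrow> 'o \<Rightarrow> 'm" where
  "nu C T M =
     ar T (tadd T M) \<cdot>\<^bsub>C\<^esub>
       pairing C (ar T (tpi0 T M)) (ar T (tpi1 T M))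
         (tlift T M \<cdot>\<^bsub>C\<^esub> tpi0 T M) (tzero T (ob T M) \<cdot>\<^bsub>C\<^esub> tpi1 T M)"

text \<open>A pullback square preserved by all powers of \<open>T\<close>; the zeroth power says that the square
  itself is a pullback.\<close>

definition is_T_pullback ::
  "('o, 'm, 'z) cat_scheme \<Rightarrow> ('o, 'm, 'y) endo_scheme
   \<Rightarrow> 'm \<Rightarrow> 'm \<Rightarrow> 'o \<Rightarrow> 'm \<Rightarrow> 'm \<Rightarrow> bool" where
  "is_T_pullback C T f g P p q \<longleftrightarrow>
     (\<forall>n. is_pullback C ((ar T ^^ n) f) ((ar T ^^ n) g) ((ob T ^^ n) P)
                        ((ar T ^^ n) p) ((ar T ^^ n) q))"

locale tangent_category = category C + endofunctor C T
  for C :: "('o, 'm, 'z) cat_scheme" (structure)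
    and T :: "('o, 'm, 'y) tangent_scheme" +
  assumes tproj_nat: "nat_trans C T endo_id (tproj T)"
    and fibre_powers_exist:
      "M \<in> Obj C \<Longrightarrow> \<exists>P b \<pi>. is_fibre_power C (tproj T M) n P b \<pi>"
    and fibre_powers_preserved:
      "M \<in> Obj C \<Longrightarrow> is_fibre_power C (tproj T M) n P b \<pi> \<Longrightarrow>
       is_fibre_power C (ar T (tproj T M)) n (ob T P) (ar T b) (\<lambda>i. ar T (\<pi> i))"
    and T2_pullback:
      "M \<in> Obj C \<Longrightarrow> is_pullback C (tproj T M) (tproj T M) (T2 T M) (tpi0 T M) (tpi1 T M)"
    and tadd_nat: "nat_trans C (T2_functor C T) T (tadd T)"
    and tzero_nat: "nat_trans C endo_id T (tzero T)"
    and tangent_bundle_additive: "M \<in> Obj C \<Longrightarrow> additive_bundle C (tangent_bundle T M)"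
    and tlift_nat: "nat_trans C T (endo_comp T T) (tlift T)"
    and tlift_additive:
      "M \<in> Obj C \<Longrightarrow>
       additive_bundle_morphism C (tangent_bundle T M) (T_tangent_bundle T M)
         (tlift T M) (tzero T M)"
    and tflip_nat: "nat_trans C (endo_comp T T) (endo_comp T T) (tflip T)"
    and tflip_tflip: "M \<in> Obj C \<Longrightarrow> tflip T M \<cdot> tflip T M = Ident C (ob T (ob T M))"
    and tflip_tlift: "M \<in> Obj C \<Longrightarrow> tflip T M \<cdot> tlift T M = tlift T M"
    and tflip_additive:
      "M \<in> Obj C \<Longrightarrow>
       additive_bundle_morphism C (T_tangent_bundle T M) (tangent_bundle T (ob T M))
         (tflip T M) (Ident C (ob T M))"
    and tlift_coassoc:
      "M \<in> Obj C \<Longrightarrow> ar T (tlift T M) \<cdot> tlift T M = tlift T (ob T M) \<cdot> tlift T M"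
    and tflip_braid:
      "M \<in> Obj C \<Longrightarrow>
       tflip T (ob T M) \<cdot> ar T (tflip T M) \<cdot> tflip T (ob T M) =
       ar T (tflip T M) \<cdot> tflip T (ob T M) \<cdot> ar T (tflip T M)"
    and tflip_tlift_compat:
      "M \<in> Obj C \<Longrightarrow>
       tflip T (ob T M) \<cdot> ar T (tflip T M) \<cdot> tlift T (ob T M) = ar T (tlift T M) \<cdot> tflip T M"
    and vertical_lift_universal:
      "M \<in> Obj C \<Longrightarrow>
       is_T_pullback C T (ar T (tproj T M)) (tzero T M)
         (T2 T M) (nu C T M) (tproj T M \<cdot> tpi0 T M)"


section \<open>Tangent dimensions\<close>

definition pi0 :: "('o, 'm, 'z) cat_scheme \<Rightarrow> 'o set set" where
  "pi0 C = iso_class C ` Obj C"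

text \<open>A tangent dimension is a function on \<open>pi0 C\<close>; it is represented by a function on all sets of
  objects, of which only the values on members of \<open>pi0 C\<close> are ever used.\<close>

definition tangent_dimension ::
  "('o, 'm, 'z) cat_scheme \<Rightarrow> ('o, 'm, 'y) tangent_scheme
   \<Rightarrow> ('o set \<Rightarrow> 'r::comm_monoid_add) \<Rightarrow> bool" where
  "tangent_dimension C T d \<longleftrightarrow>
     (\<forall>r f P p q.
        is_T_pullback C T r f P p q \<and> is_retraction C r \<and> (is_retraction C f \<or> is_section C f) \<longrightarrow>
        d (iso_class C P) + d (iso_class C (Cod C r)) =
        d (iso_class C (Dom C r)) + d (iso_class C (Dom C f)))"

text \<open>The sort is that of commutative rigs; \<open>0 = 1\<close> is not excluded.\<close>

definition strong_tangent_dimension ::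
  "('o, 'm, 'z) cat_scheme \<Rightarrow> ('o, 'm, 'y) tangent_scheme
   \<Rightarrow> ('o set \<Rightarrow> 'r::{comm_semiring_0, comm_monoid_mult}) \<Rightarrow> bool" where
  "strong_tangent_dimension C T d \<longleftrightarrow>
     tangent_dimension C T d \<and>
     (\<exists>a. \<forall>X\<in>Obj C. d (iso_class C (ob T X)) = a * d (iso_class C X))"

end

theory Submission
  imports Defs
begin

text \<open>Let \<open>d = dim X\<close> and \<open>dim (T X) = a d\<close>. The pullback \<open>T\<^sub>2X\<close> of \<open>p\<^sub>X\<close> along itself gives
  \<open>dim (T\<^sub>2X) + d = 2 a d\<close>, and the universality of the vertical lift, a pullback of the retraction
  \<open>T(p\<^sub>X)\<close> along the section \<open>0\<^sub>X\<close>, gives \<open>dim (T\<^sub>2X) + a d = a\<^sup>2 d + d\<close>. Hence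
  \<open>(a - 1) (a - 2) d = 0\<close>. The axioms only provide that \<open>T\<close> itself preserves the first pullback; all
  powers of \<open>T\<close> do since the canonical flip identifies \<open>T\<^sup>n(p\<^sub>X)\<close> with \<open>p\<close> at \<open>T\<^sup>nX\<close>.\<close>

section \<open>Kernel pairs in a category\<close>

lemma HomD: "f \<in> Hom C A B \<Longrightarrow> f \<in> Arr C \<and> Dom C f = A \<and> Cod C f = B"
  by (simp add: Hom_def)

context category
begin

lemma Hom_Obj: "f \<in> Hom C A B \<Longrightarrow> A \<in> Obj C \<and> B \<in> Obj C"
  using Dom_closed Cod_closed by (auto simp: Hom_def)

text \<open>Preservation by \<open>T\<close> is axiomatised for fibre powers, whereas T-pullbacks
  are about squares; this translates between the two. The structure map of a twofold fibre power is
  forced to be the common composite with \<open>f\<close>.\<close>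

lemma fibre_power_2_iff_pullback:
  "is_fibre_power C f 2 P b \<pi> \<longleftrightarrow> is_pullback C f f P (\<pi> 0) (\<pi> 1) \<and> f \<cdot> \<pi> 0 = b"
proof -
  have all2: "(\<forall>i<2. Q i) \<longleftrightarrow> Q 0 \<and> Q 1" for Q :: "nat \<Rightarrow> bool"
    by (auto simp: less_2_cases_iff)
  show ?thesis
  proof
    assume fp: "is_fibre_power C f 2 P b \<pi>"
    then have f: "f \<in> Arr C" and P: "P \<in> Obj C" and b: "b \<in> Hom C P (Cod C f)"
      and pi: "\<pi> 0 \<in> Hom C P (Dom C f)" "\<pi> 1 \<in> Hom C P (Dom C f)"
        "f \<cdot> \<pi> 0 = b" "f \<cdot> \<pi> 1 = b"
      by (simp_all add: is_fibre_power_def all2)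
    have fH: "f \<in> Hom C (Dom C f) (Cod C f)" using f by (simp add: Hom_def)
    have "\<exists>!u. u \<in> Hom C Z P \<and> \<pi> 0 \<cdot> u = x \<and> \<pi> 1 \<cdot> u = y"
      if Z: "Z \<in> Obj C" and x: "x \<in> Hom C Z (Dom C f)" and y: "y \<in> Hom C Z (Dom C f)"
        and eq: "f \<cdot> x = f \<cdot> y" for Z x y
    proof -
      have "f \<cdot> x \<in> Hom C Z (Cod C f)" using x fH by (rule Comp_Hom)
      \<comment> \<open>\<open>case_nat x (\<lambda>_. y)\<close> turns the pair into an indexed
        family: index 0 gives \<open>x\<close>, index 1 gives \<open>y\<close>.\<close>
      moreover have "\<forall>i<2. case_nat x (\<lambda>_. y) i \<in> Hom C Z (Dom C f) \<and>
          f \<cdot> case_nat x (\<lambda>_. y) i = f \<cdot> x"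
        using x y eq by (simp add: all2)
      ultimately have "\<exists>!u. u \<in> Hom C Z P \<and> b \<cdot> u = f \<cdot> x \<and>
          (\<forall>i<2. \<pi> i \<cdot> u = case_nat x (\<lambda>_. y) i)"
        using fp Z unfolding is_fibre_power_def by blast
      then have "\<exists>!u. u \<in> Hom C Z P \<and> b \<cdot> u = f \<cdot> x \<and> \<pi> 0 \<cdot> u = x \<and> \<pi> 1 \<cdot> u = y"
        by (simp add: all2)
      moreover have "b \<cdot> u = f \<cdot> x" if "u \<in> Hom C Z P" "\<pi> 0 \<cdot> u = x" for u
        using Comp_assoc[OF that(1) pi(1) fH] that pi by simp
      ultimately show ?thesis by metis
    qed
    then show "is_pullback C f f P (\<pi> 0) (\<pi> 1) \<and> f \<cdot> \<pi> 0 = b"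
      using f P pi by (simp add: is_pullback_def)
  next
    assume pb: "is_pullback C f f P (\<pi> 0) (\<pi> 1) \<and> f \<cdot> \<pi> 0 = b"
    then have f: "f \<in> Arr C" and P: "P \<in> Obj C"
      and pi: "\<pi> 0 \<in> Hom C P (Dom C f)" "\<pi> 1 \<in> Hom C P (Dom C f)"
        "f \<cdot> \<pi> 0 = b" "f \<cdot> \<pi> 1 = b"
      unfolding is_pullback_def by metis+
    have fH: "f \<in> Hom C (Dom C f) (Cod C f)" using f by (simp add: Hom_def)
    have b: "b \<in> Hom C P (Cod C f)" using Comp_Hom[OF pi(1) fH] pi by simp
    have univ: "\<exists>!u. u \<in> Hom C Z P \<and> b \<cdot> u = h \<and> (\<forall>i<2. \<pi> i \<cdot> u = x i)"
      if Z: "Z \<in> Obj C" and x: "\<forall>i<2. x i \<in> Hom C Z (Dom C f) \<and> f \<cdot> x i = h" for Z h and x :: "nat \<Rightarrow> 'm"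
    proof -
      have x01: "x 0 \<in> Hom C Z (Dom C f)" "x 1 \<in> Hom C Z (Dom C f)" "f \<cdot> x 0 = h" "f \<cdot> x 1 = h"
        using x by (simp_all add: all2)
      then have "\<exists>!u. u \<in> Hom C Z P \<and> \<pi> 0 \<cdot> u = x 0 \<and> \<pi> 1 \<cdot> u = x 1"
        using pb Z unfolding is_pullback_def by metis
      moreover have "b \<cdot> u = h" if "u \<in> Hom C Z P" "\<pi> 0 \<cdot> u = x 0" for u
        using Comp_assoc[OF that(1) pi(1) fH] that pi x01 by simp
      ultimately show ?thesis unfolding all2 by metis
    qed
    have "\<forall>i<2. \<pi> i \<in> Hom C P (Dom C f) \<and> f \<cdot> \<pi> i = b"
      using pi by (simp add: all2)
    then show "is_fibre_power C f 2 P b \<pi>"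
      unfolding is_fibre_power_def using f P b univ by blast
  qed
qed

text \<open>Composition with the inverse \<open>t\<close> turns a cone over \<open>f\<close>,
  \<open>f\<close> into a cone over \<open>f \<cdot> s\<close>, \<open>f \<cdot> s\<close> with the
  same mediating morphisms, so kernel pairs transport along an isomorphism of the domain.\<close>

lemma pullback_kernel_pair_iso:
  assumes pb: "is_pullback C (f \<cdot> s) (f \<cdot> s) P u v"
    and f: "f \<in> Hom C A B" and s: "s \<in> Hom C A' A" and t: "t \<in> Hom C A A'"
    and ts: "t \<cdot> s = Ident C A'" and st: "s \<cdot> t = Ident C A"
  shows "is_pullback C f f P (s \<cdot> u) (s \<cdot> v)"
proof -
  note fD = HomD[OF f] and fsD = HomD[OF Comp_Hom[OF s f]]
  have P: "P \<in> Obj C" and u: "u \<in> Hom C P A'" and v: "v \<in> Hom C P A'"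
    and eq: "f \<cdot> s \<cdot> u = f \<cdot> s \<cdot> v"
    and univ: "\<And>Z x y. Z \<in> Obj C \<Longrightarrow> x \<in> Hom C Z A' \<Longrightarrow> y \<in> Hom C Z A' \<Longrightarrow> f \<cdot> s \<cdot> x = f \<cdot> s \<cdot> y \<Longrightarrow>
      \<exists>!w. w \<in> Hom C Z P \<and> u \<cdot> w = x \<and> v \<cdot> w = y"
    using pb fsD by (simp_all add: is_pullback_def)
  have st': "s \<cdot> (t \<cdot> x) = x" if "x \<in> Hom C Z A" for x Z
    using Comp_assoc[OF that t s] Id_Comp[OF that] st by simp
  have ts': "t \<cdot> (s \<cdot> x) = x" if "x \<in> Hom C Z A'" for x Z
    using Comp_assoc[OF that s t] Id_Comp[OF that] ts by simp
  have "\<exists>!w. w \<in> Hom C Z P \<and> s \<cdot> u \<cdot> w = x \<and> s \<cdot> v \<cdot> w = y"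
    if Z: "Z \<in> Obj C" and x: "x \<in> Hom C Z A" and y: "y \<in> Hom C Z A" and xy: "f \<cdot> x = f \<cdot> y" for Z x y
  proof -
    have tx: "t \<cdot> x \<in> Hom C Z A'" and ty: "t \<cdot> y \<in> Hom C Z A'"
      using Comp_Hom[OF x t] Comp_Hom[OF y t] .
    have "f \<cdot> s \<cdot> (t \<cdot> x) = f \<cdot> s \<cdot> (t \<cdot> y)"
      using Comp_assoc[OF tx s f] Comp_assoc[OF ty s f] st'[OF x] st'[OF y] xy by simp
    then have "\<exists>!w. w \<in> Hom C Z P \<and> u \<cdot> w = t \<cdot> x \<and> v \<cdot> w = t \<cdot> y"
      using univ Z tx ty by blast
    moreover have "s \<cdot> u \<cdot> w = x \<longleftrightarrow> u \<cdot> w = t \<cdot> x" "s \<cdot> v \<cdot> w = y \<longleftrightarrow> v \<cdot> w = t \<cdot> y"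
      if w: "w \<in> Hom C Z P" for w
      using Comp_assoc[OF w u s] Comp_assoc[OF w v s] st'[OF x] st'[OF y]
        ts'[OF Comp_Hom[OF w u]] ts'[OF Comp_Hom[OF w v]] by metis+
    ultimately show ?thesis by metis
  qed
  then show ?thesis
    using fD P Comp_Hom[OF u s] Comp_Hom[OF v s] eq Comp_assoc[OF u s f] Comp_assoc[OF v s f]
    by (simp add: is_pullback_def)
qed

end

section \<open>Kernel pairs of the projections under powers of \<open>T\<close>\<close>

context tangent_category
begin

lemma tproj_Hom: "M \<in> Obj C \<Longrightarrow> tproj T M \<in> Hom C (ob T M) M"
  using tproj_nat by (simp add: nat_trans_def endo_id_def)

lemma tzero_Hom: "M \<in> Obj C \<Longrightarrow> tzero T M \<in> Hom C M (ob T M)"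
  using tzero_nat by (simp add: nat_trans_def endo_id_def)

lemma tflip_Hom: "M \<in> Obj C \<Longrightarrow> tflip T M \<in> Hom C (ob T (ob T M)) (ob T (ob T M))"
  using tflip_nat by (simp add: nat_trans_def endo_comp_def)

lemma tproj_tzero: "M \<in> Obj C \<Longrightarrow> tproj T M \<cdot> tzero T M = Ident C M"
  using additive_bundle.bproj_bzero[OF tangent_bundle_additive] by (simp add: tangent_bundle_def)

lemma tproj_tflip:
  assumes M: "M \<in> Obj C"
  shows "tproj T (ob T M) \<cdot> tflip T M = ar T (tproj T M)"
proof -
  have "tproj T (ob T M) \<cdot> tflip T M = Ident C (ob T M) \<cdot> ar T (tproj T M)"
    using additive_bundle_morphism.commutes_proj[OF tflip_additive[OF M]]
    by (simp add: tangent_bundle_def T_tangent_bundle_def)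
  then show ?thesis
    using Id_Comp[OF ar_Hom[OF tproj_Hom[OF M]]] by simp
qed

lemma ob_funpow_closed: "M \<in> Obj C \<Longrightarrow> (ob T ^^ n) M \<in> Obj C"
  by (induction n) (auto intro: ob_closed)

lemma ar_funpow_Hom:
  "f \<in> Hom C A B \<Longrightarrow> (ar T ^^ n) f \<in> Hom C ((ob T ^^ n) A) ((ob T ^^ n) B)"
  by (induction n) (auto intro: ar_Hom)

text \<open>The preservation axiom for fibre powers at exponent 2. It covers only a single
  application of \<open>T\<close>, and only to projections of the form
  \<open>tproj T M\<close>.\<close>

lemma pullback_tproj_preserved:
  assumes M: "M \<in> Obj C" and pb: "is_pullback C (tproj T M) (tproj T M) P u v"
  shows "is_pullback C (ar T (tproj T M)) (ar T (tproj T M)) (ob T P) (ar T u) (ar T v)"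
proof -
  have "is_fibre_power C (tproj T M) 2 P (tproj T M \<cdot> u) (case_nat u (\<lambda>_. v))"
    using pb by (simp add: fibre_power_2_iff_pullback)
  from fibre_powers_preserved[OF M this] show ?thesis
    by (simp add: fibre_power_2_iff_pullback)
qed

text \<open>The flip exchanges \<open>T(p)\<close> with \<open>p\<close> one level up. By induction,
  applying \<open>T\<close> to the isomorphism for \<open>n\<close> and then the flip gives the one
  for \<open>n + 1\<close>.\<close>

lemma tproj_funpow_iso:
  assumes M: "M \<in> Obj C"
  shows "\<exists>s\<in>Hom C ((ob T ^^ n) (ob T M)) (ob T ((ob T ^^ n) M)).
         \<exists>t\<in>Hom C (ob T ((ob T ^^ n) M)) ((ob T ^^ n) (ob T M)).
           t \<cdot> s = Ident C ((ob T ^^ n) (ob T M)) \<and>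
           s \<cdot> t = Ident C (ob T ((ob T ^^ n) M)) \<and>
           tproj T ((ob T ^^ n) M) \<cdot> s = (ar T ^^ n) (tproj T M)"
proof (induction n)
  case 0
  show ?case
    using Id_Hom[OF ob_closed[OF M]] Comp_Id[OF Id_Hom[OF ob_closed[OF M]]]
      Comp_Id[OF tproj_Hom[OF M]] by auto
next
  case (Suc n)
  let ?A = "(ob T ^^ n) (ob T M)" and ?N = "(ob T ^^ n) M"
  have N: "?N \<in> Obj C" by (rule ob_funpow_closed[OF M])
  from Suc obtain s t where s: "s \<in> Hom C ?A (ob T ?N)" and t: "t \<in> Hom C (ob T ?N) ?A"
    and ts: "t \<cdot> s = Ident C ?A" and st: "s \<cdot> t = Ident C (ob T ?N)"
    and ps: "tproj T ?N \<cdot> s = (ar T ^^ n) (tproj T M)" by blast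
  note c = tflip_Hom[OF N] and Ts = ar_Hom[OF s] and Tt = ar_Hom[OF t]
  note cTs = Comp_Hom[OF Ts c] and Ttc = Comp_Hom[OF c Tt]
  have A: "?A \<in> Obj C" using Hom_Obj[OF s] by blast
  have Tst: "ar T s \<cdot> ar T t = Ident C (ob T (ob T ?N))"
    using ar_Comp[OF t s] ar_Id[OF ob_closed[OF N]] st by simp
  have Tts: "ar T t \<cdot> ar T s = Ident C (ob T ?A)"
    using ar_Comp[OF s t] ar_Id[OF A] ts by simp
  \<comment> \<open>The new pair is \<open>c \<cdot> T(s)\<close> and \<open>T(t) \<cdot> c\<close>,
    with \<open>c\<close> the flip at \<open>?N\<close>; they are mutually inverse because
    \<open>c\<close> is an involution.\<close>
  have 1: "(ar T t \<cdot> tflip T ?N) \<cdot> (tflip T ?N \<cdot> ar T s) = Ident C (ob T ?A)"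
    using Comp_assoc[OF cTs c Tt] Comp_assoc[OF Ts c c] tflip_tflip[OF N] Id_Comp[OF Ts] Tts
    by simp
  have 2: "(tflip T ?N \<cdot> ar T s) \<cdot> (ar T t \<cdot> tflip T ?N) = Ident C (ob T (ob T ?N))"
    using Comp_assoc[OF Ttc Ts c] Comp_assoc[OF c Tt Ts] tflip_tflip[OF N] Id_Comp[OF c] Tst
    by simp
  have 3: "tproj T (ob T ?N) \<cdot> (tflip T ?N \<cdot> ar T s) = ar T ((ar T ^^ n) (tproj T M))"
    using Comp_assoc[OF Ts c tproj_Hom[OF ob_closed[OF N]]] tproj_tflip[OF N]
      ar_Comp[OF s tproj_Hom[OF N]] ps by simp
  show ?case
    using cTs Ttc 1 2 3 by auto
qed

text \<open>Induction on the power: the square for \<open>n\<close> is moved along \<open>s\<close>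
  to a kernel pair of a genuine projection \<open>tproj T ?N\<close>, where the axiom allows one
  more \<open>T\<close>, and is then moved back along \<open>T(t)\<close>.\<close>

lemma T2_T_pullback:
  assumes M: "M \<in> Obj C"
  shows "is_T_pullback C T (tproj T M) (tproj T M) (T2 T M) (tpi0 T M) (tpi1 T M)"
  unfolding is_T_pullback_def
proof
  fix n
  let ?p = "tproj T M" and ?u = "tpi0 T M" and ?v = "tpi1 T M"
  show "is_pullback C ((ar T ^^ n) ?p) ((ar T ^^ n) ?p) ((ob T ^^ n) (T2 T M))
          ((ar T ^^ n) ?u) ((ar T ^^ n) ?v)"
  proof (induction n)
    case 0
    show ?case using T2_pullback[OF M] by simp
  next
    case (Suc n)
    let ?A = "(ob T ^^ n) (ob T M)" and ?N = "(ob T ^^ n) M" and ?P = "(ob T ^^ n) (T2 T M)"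
    let ?Tp = "(ar T ^^ n) ?p" and ?Tu = "(ar T ^^ n) ?u" and ?Tv = "(ar T ^^ n) ?v"
    have N: "?N \<in> Obj C" by (rule ob_funpow_closed[OF M])
    from tproj_funpow_iso[OF M] obtain s t where
      s: "s \<in> Hom C ?A (ob T ?N)" and t: "t \<in> Hom C (ob T ?N) ?A"
      and ts: "t \<cdot> s = Ident C ?A" and st: "s \<cdot> t = Ident C (ob T ?N)"
      and ps: "tproj T ?N \<cdot> s = ?Tp" by blast
    note Ts = ar_Hom[OF s] and Tt = ar_Hom[OF t]
    have A: "?A \<in> Obj C" using Hom_Obj[OF s] by blast
    have Tst: "ar T s \<cdot> ar T t = Ident C (ob T (ob T ?N))"
      using ar_Comp[OF t s] ar_Id[OF ob_closed[OF N]] st by simp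
    have Tts: "ar T t \<cdot> ar T s = Ident C (ob T ?A)"
      using ar_Comp[OF s t] ar_Id[OF A] ts by simp
    note pN = tproj_Hom[OF N]
    have uv: "?u \<in> Hom C (T2 T M) (ob T M)" "?v \<in> Hom C (T2 T M) (ob T M)"
      using T2_pullback[OF M] HomD[OF tproj_Hom[OF M]] by (simp_all add: is_pullback_def)
    note Tu = ar_funpow_Hom[OF uv(1), of n] and Tv = ar_funpow_Hom[OF uv(2), of n]
    have "is_pullback C (tproj T ?N) (tproj T ?N) ?P (s \<cdot> ?Tu) (s \<cdot> ?Tv)"
      using Suc pullback_kernel_pair_iso[OF _ pN s t ts st] ps by simp
    then have "is_pullback C (ar T (tproj T ?N)) (ar T (tproj T ?N)) (ob T ?P)
        (ar T s \<cdot> ar T ?Tu) (ar T s \<cdot> ar T ?Tv)"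
      using pullback_tproj_preserved[OF N] ar_Comp[OF Tu s] ar_Comp[OF Tv s] by fastforce
    \<comment> \<open>This factorisation exhibits the projection as a map precomposed with the
      isomorphism \<open>T(t)\<close>, the form needed for transporting back.\<close>
    moreover have "ar T (tproj T ?N) = ar T ?Tp \<cdot> ar T t"
    proof -
      have "tproj T ?N = ?Tp \<cdot> t"
        using Comp_assoc[OF t s pN] st Comp_Id[OF pN] ps by simp
      then show ?thesis
        using ar_Comp[OF t ar_funpow_Hom[OF tproj_Hom[OF M]]] by simp
    qed
    ultimately have "is_pullback C (ar T ?Tp) (ar T ?Tp) (ob T ?P)
        (ar T t \<cdot> (ar T s \<cdot> ar T ?Tu)) (ar T t \<cdot> (ar T s \<cdot> ar T ?Tv))"
      using pullback_kernel_pair_iso[OF _ ar_Hom[OF ar_funpow_Hom[OF tproj_Hom[OF M]]] Tt Ts Tst Tts]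
      by simp
    \<comment> \<open>The two transports cancel, leaving the original projections under one more
      \<open>T\<close>.\<close>
    moreover have "ar T t \<cdot> (ar T s \<cdot> ar T x) = ar T x" if "x \<in> Hom C ?P ?A" for x
      using Comp_assoc[OF ar_Hom[OF that] Ts Tt] Id_Comp[OF ar_Hom[OF that]] Tts by simp
    ultimately show ?case
      using Tu Tv by simp
  qed
qed

section \<open>Split maps and dimension equations\<close>

lemma tproj_retraction: "M \<in> Obj C \<Longrightarrow> is_retraction C (tproj T M)"
  using HomD[OF tproj_Hom] tzero_Hom tproj_tzero by (auto simp: is_retraction_def)

lemma tzero_section: "M \<in> Obj C \<Longrightarrow> is_section C (tzero T M)"
  using HomD[OF tzero_Hom] tproj_Hom tproj_tzero by (auto simp: is_section_def)

lemma ar_tproj_retraction: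
  assumes M: "M \<in> Obj C"
  shows "is_retraction C (ar T (tproj T M))"
proof -
  have "ar T (tproj T M) \<cdot> ar T (tzero T M) = Ident C (ob T M)"
    using ar_Comp[OF tzero_Hom[OF M] tproj_Hom[OF M]] tproj_tzero[OF M] ar_Id[OF M] by simp
  then show ?thesis
    using HomD[OF ar_Hom[OF tproj_Hom[OF M]]] ar_Hom[OF tzero_Hom[OF M]]
    by (auto simp: is_retraction_def)
qed

text \<open>Both legs are \<open>tproj T M\<close>, split by the zero section, so the dimension
  axiom applies in its retraction case.\<close>

lemma dim_T2:
  assumes dim: "tangent_dimension C T dim" and M: "M \<in> Obj C"
  shows "dim (iso_class C (T2 T M)) + dim (iso_class C M) =
         dim (iso_class C (ob T M)) + dim (iso_class C (ob T M))"
  using dim T2_T_pullback[OF M] tproj_retraction[OF M] HomD[OF tproj_Hom[OF M]]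
  unfolding tangent_dimension_def by metis

text \<open>Here the second leg is the zero section, so the section case of the dimension axiom is
  used.\<close>

lemma dim_vertical_lift:
  assumes dim: "tangent_dimension C T dim" and M: "M \<in> Obj C"
  shows "dim (iso_class C (T2 T M)) + dim (iso_class C (ob T M)) =
         dim (iso_class C (ob T (ob T M))) + dim (iso_class C M)"
  using dim vertical_lift_universal[OF M] ar_tproj_retraction[OF M] tzero_section[OF M]
    HomD[OF ar_Hom[OF tproj_Hom[OF M]]] HomD[OF tzero_Hom[OF M]]
  unfolding tangent_dimension_def by metis

end

theorem theorem3p8:
  fixes C :: "('o, 'm) cat"
    and T :: "('o, 'm) tangent"
    and dim :: "'o set \<Rightarrow> 'r::idom"
    and X :: 'o
  assumes "tangent_category C T"
    and "strong_tangent_dimension C T dim"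
    and "X \<in> Obj C"
  shows "dim (iso_class C (ob T X)) = dim (iso_class C X) \<or>
         dim (iso_class C (ob T X)) = 2 * dim (iso_class C X)"
proof -
  interpret tangent_category C T by fact
  let ?d = "dim (iso_class C X)" and ?e = "dim (iso_class C (T2 T X))"
  from assms(2) obtain a where dim: "tangent_dimension C T dim"
    and a: "\<And>Y. Y \<in> Obj C \<Longrightarrow> dim (iso_class C (ob T Y)) = a * dim (iso_class C Y)"
    by (auto simp: strong_tangent_dimension_def)
  have TX: "dim (iso_class C (ob T X)) = a * ?d"
    using a assms(3) by simp
  have TTX: "dim (iso_class C (ob T (ob T X))) = a * (a * ?d)"
    using a ob_closed assms(3) by simp
  have 1: "?e + ?d = a * ?d + a * ?d"
    using dim_T2[OF dim assms(3)] TX by simp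
  have 2: "?e + a * ?d = a * (a * ?d) + ?d"
    using dim_vertical_lift[OF dim assms(3)] TX TTX by simp
  have "?e = a * ?d + a * ?d - ?d"
    using 1 by (simp add: eq_diff_eq)
  \<comment> \<open>Eliminating \<open>?e\<close> leaves
    \<open>a * (a * ?d) - 3 * (a * ?d) + 2 * ?d = 0\<close>, whose left side factors.\<close>
  with 2 have "(a - 1) * (a - 2) * ?d = 0"
    by (simp add: algebra_simps)
  \<comment> \<open>Without zero divisors, \<open>a = 1\<close>, \<open>a = 2\<close> or
    \<open>?d = 0\<close>; in the last case both dimensions vanish.\<close>
  then show ?thesis
    using TX by auto
qed

end
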